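(* Let $(X,\mathcal{C})$ be any Baire base and let $A\subseteq X$. Then $A$ is non-Baire if and only if there is a region $D\in\mathcal{C}$ such that $A$ is completely non-Baire in $D$.
   Context: A category base is a pair $(X,\mathcal{C})$ where $X$ is a non-empty set and $\mathcal{C}$ is a family of subsets of $X$, called regions, satisfying the following axioms. (1) Every point of $X$ belongs to some region, i.e. $X=\bigcup\mathcal{C}$. (2) Let $A$ be a region and $\mathcal{D}$ a non-empty family of disjoint regions having cardinality less than the cardinality of $\mathcal{C}$. (i) If $A\cap(\bigcup\mathcal{D})$ contains a region, then there is a region $D\in\mathcal{D}$ such that $A\cap D$ contains a region. (ii) If $A\cap(\bigcup\mathcal{D})$ contains no region, then there is a region $B\subseteq A$ that is disjoint from every region in $\mathcal{D}$. A subregion of a region $C$ is a region contained in $C$. A set is singular if every region contains a subregion which is disjoint from the set. A set is meager if it can be expressed as a countable union of singular sets; otherwise it is abundant. A set $S\subseteq X$ is meager (abundant) in a region $D$ if $S\cap D$ is meager (abundant). A set $S\subseteq X$ is Baire if in every region there is a subregion in which either $S$ or its complement $X-S$ is meager; a set is non-Baire if it is not Baire. A Baire base is a category base all of whose regions are abundant sets. A set $A$ is called completely non-Baire in a region $D$ if for every Baire set $B$ such that $B\cap D$ is abundant, both $A\cap B$ and $(D-A)\cap B$ are abundant. *)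

theory Defs
  imports Main "HOL-Library.Equipollence" "HOL-Library.Disjoint_Sets" "HOL-Library.Countable_Set"
begin

definition subregion :: "'a set set \<Rightarrow> 'a set \<Rightarrow> 'a set \<Rightarrow> bool" where
  "subregion \<C> E D \<longleftrightarrow> E \<in> \<C> \<and> E \<subseteq> D"

text \<open>
  The empty set is not excluded from being a region of a category base.  If it is one, then every
  subset of X is singular, so the empty set is never a region of a Baire base (as defined below).
\<close>

locale category_base =
  fixes X :: "'a set" and \<C> :: "'a set set"
  assumes nonempty: "X \<noteq> {}"
    and covers: "X = \<Union>\<C>"
    and contains_region:
      "\<lbrakk>A \<in> \<C>; \<D> \<noteq> {}; \<D> \<subseteq> \<C>; disjoint \<D>; \<D> \<prec> \<C>; \<exists>R. subregion \<C> R (A \<inter> \<Union>\<D>)\<rbrakk>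
        \<Longrightarrow> \<exists>D\<in>\<D>. \<exists>R. subregion \<C> R (A \<inter> D)"
    and contains_no_region:
      "\<lbrakk>A \<in> \<C>; \<D> \<noteq> {}; \<D> \<subseteq> \<C>; disjoint \<D>; \<D> \<prec> \<C>; \<nexists>R. subregion \<C> R (A \<inter> \<Union>\<D>)\<rbrakk>
        \<Longrightarrow> \<exists>B. subregion \<C> B A \<and> (\<forall>D\<in>\<D>. disjnt B D)"

definition singular_set :: "'a set \<Rightarrow> 'a set set \<Rightarrow> 'a set \<Rightarrow> bool" where
  "singular_set X \<C> S \<longleftrightarrow> S \<subseteq> X \<and> (\<forall>D\<in>\<C>. \<exists>E. subregion \<C> E D \<and> disjnt E S)"

definition meager_set :: "'a set \<Rightarrow> 'a set set \<Rightarrow> 'a set \<Rightarrow> bool" where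
  "meager_set X \<C> S \<longleftrightarrow> (\<exists>\<F>. countable \<F> \<and> (\<forall>T\<in>\<F>. singular_set X \<C> T) \<and> S = \<Union>\<F>)"

definition abundant_set :: "'a set \<Rightarrow> 'a set set \<Rightarrow> 'a set \<Rightarrow> bool" where
  "abundant_set X \<C> S \<longleftrightarrow> S \<subseteq> X \<and> \<not> meager_set X \<C> S"

definition meager_in :: "'a set \<Rightarrow> 'a set set \<Rightarrow> 'a set \<Rightarrow> 'a set \<Rightarrow> bool" where
  "meager_in X \<C> S D \<longleftrightarrow> meager_set X \<C> (S \<inter> D)"

definition baire_set :: "'a set \<Rightarrow> 'a set set \<Rightarrow> 'a set \<Rightarrow> bool" where
  "baire_set X \<C> S \<longleftrightarrow> S \<subseteq> X \<and>
    (\<forall>D\<in>\<C>. \<exists>E. subregion \<C> E D \<and> (meager_in X \<C> S E \<or> meager_in X \<C> (X - S) E))"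

definition nonbaire_set :: "'a set \<Rightarrow> 'a set set \<Rightarrow> 'a set \<Rightarrow> bool" where
  "nonbaire_set X \<C> S \<longleftrightarrow> S \<subseteq> X \<and> \<not> baire_set X \<C> S"

text \<open>
  In the next definition A is not required to be a subset of D, and its first conclusion concerns
  the intersection of A and B, not of A, B and D.
\<close>

definition completely_nonbaire_in :: "'a set \<Rightarrow> 'a set set \<Rightarrow> 'a set \<Rightarrow> 'a set \<Rightarrow> bool" where
  "completely_nonbaire_in X \<C> A D \<longleftrightarrow> A \<subseteq> X \<and>
    (\<forall>B. baire_set X \<C> B \<and> abundant_set X \<C> (B \<inter> D) \<longrightarrow>
      abundant_set X \<C> (A \<inter> B) \<and> abundant_set X \<C> ((D - A) \<inter> B))"

locale baire_base = category_base +
  assumes region_abundant: "D \<in> \<C> \<Longrightarrow> abundant_set X \<C> D"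

end

theory Submission
  imports Defs
begin

text \<open>
  The heart is the Banach category theorem for category bases: a set that is meager in a subregion
  of every region is meager. Given it, an abundant set \<open>B \<inter> D\<close> with \<open>B\<close> Baire is abundant in every
  subregion of some region; shrinking that region, \<open>B\<close> becomes comeager in a region \<open>G \<subseteq> D\<close>.
  If \<open>A\<close> and its complement are abundant in every subregion of \<open>D\<close>, they are
  abundant in \<open>G\<close> and hence meet \<open>B\<close> in abundant sets. For the converse, regions are Baire sets, so
  complete non-Baireness in \<open>D\<close> can be tested on every subregion of \<open>D\<close>.
\<close>

context category_base
begin

section \<open>Singular and meager sets\<close>

lemma region_subset: "D \<in> \<C> \<Longrightarrow> D \<subseteq> X"
  using covers by auto

lemma singular_empty: "singular_set X \<C> {}"
  unfolding singular_set_def subregion_def by auto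

lemma singular_subset:
  assumes "singular_set X \<C> S" and "T \<subseteq> S"
  shows "singular_set X \<C> T"
  using assms unfolding singular_set_def disjnt_def by blast

text \<open>Indexing the singular pieces by \<open>nat\<close> makes it possible to unite, for each
  fixed \<open>n\<close>, the \<open>n\<close>-th pieces of many meager sets at once;
  \<open>banach_category\<close> depends on this.\<close>

lemma meager_iff_sequence:
  "meager_set X \<C> S \<longleftrightarrow> (\<exists>T::nat \<Rightarrow> 'a set. (\<forall>n. singular_set X \<C> (T n)) \<and> S = (\<Union>n. T n))"
proof
  assume "meager_set X \<C> S"
  then obtain F where F: "countable F" "\<forall>T\<in>F. singular_set X \<C> T" "S = \<Union>F"
    unfolding meager_set_def by blast
  \<comment> \<open>Adding the singular set \<open>{}\<close> keeps the enumerated family nonempty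
    without changing its union.\<close>
  let ?T = "from_nat_into (insert {} F)"
  have range: "range ?T = insert {} F"
    using F(1) by (intro range_from_nat_into) auto
  have "singular_set X \<C> (?T n)" for n
    using F(2) singular_empty range rangeI[of ?T n] by auto
  moreover have "S = (\<Union>n. ?T n)"
    using F(3) range by simp
  ultimately show "\<exists>T::nat \<Rightarrow> 'a set. (\<forall>n. singular_set X \<C> (T n)) \<and> S = (\<Union>n. T n)"
    by blast
next
  assume "\<exists>T::nat \<Rightarrow> 'a set. (\<forall>n. singular_set X \<C> (T n)) \<and> S = (\<Union>n. T n)"
  then obtain T :: "nat \<Rightarrow> 'a set" where "\<forall>n. singular_set X \<C> (T n)" "S = (\<Union>n. T n)"
    by blast
  then show "meager_set X \<C> S"
    unfolding meager_set_def by (intro exI[of _ "range T"]) auto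
qed

lemma singular_imp_meager: "singular_set X \<C> S \<Longrightarrow> meager_set X \<C> S"
  unfolding meager_set_def by (intro exI[of _ "{S}"]) auto

lemma meager_empty: "meager_set X \<C> {}"
  by (simp add: singular_imp_meager singular_empty)

lemma meager_subset:
  assumes "meager_set X \<C> S" and "T \<subseteq> S"
  shows "meager_set X \<C> T"
proof -
  obtain U :: "nat \<Rightarrow> 'a set" where U: "\<And>n. singular_set X \<C> (U n)" "S = (\<Union>n. U n)"
    using assms(1) unfolding meager_iff_sequence by blast
  have "singular_set X \<C> (T \<inter> U n)" for n
    using U(1) by (rule singular_subset) auto
  moreover have "T = (\<Union>n. T \<inter> U n)"
    using U(2) assms(2) by auto
  ultimately show ?thesis
    unfolding meager_iff_sequence by (intro exI[of _ "\<lambda>n. T \<inter> U n"] conjI allI)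
qed

lemma meager_Un:
  assumes "meager_set X \<C> S" and "meager_set X \<C> T"
  shows "meager_set X \<C> (S \<union> T)"
proof -
  obtain F G where "countable F" "\<forall>T\<in>F. singular_set X \<C> T" "S = \<Union>F"
    and "countable G" "\<forall>T\<in>G. singular_set X \<C> T" "T = \<Union>G"
    using assms unfolding meager_set_def by blast
  then show ?thesis
    unfolding meager_set_def by (intro exI[of _ "F \<union> G"]) auto
qed

section \<open>Two regions, and regions as Baire sets\<close>

text \<open>The second axiom is applied to the family \<open>{D}\<close>. Its cardinality is below
  that of \<open>\<C>\<close> as soon as there is a second region, so the case \<open>D = E\<close>
  is treated apart.\<close>

lemma region_inter_or_disjoint:
  assumes "D \<in> \<C>" and "E \<in> \<C>"
  obtains G where "subregion \<C> G (D \<inter> E)" | G where "subregion \<C> G E" and "disjnt G D"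
proof (cases "D = E")
  case True
  then show thesis
    using that(1)[of D] assms by (simp add: subregion_def)
next
  case False
  have "\<not> \<C> \<lesssim> {D}"
  proof
    assume "\<C> \<lesssim> {D}"
    then obtain f where f: "inj_on f \<C>" "f ` \<C> \<subseteq> {D}"
      unfolding lepoll_def by blast
    then have "f D = f E"
      using assms by auto
    with f(1) assms False show False
      by (simp add: inj_on_eq_iff)
  qed
  then have "{D} \<prec> \<C>"
    using assms subset_imp_lepoll[of "{D}" \<C>] eqpoll_imp_lepoll eqpoll_sym
    unfolding lesspoll_def by blast
  then have "(\<exists>R. subregion \<C> R (E \<inter> D)) \<or> (\<exists>B. subregion \<C> B E \<and> disjnt B D)"
    using contains_no_region[of E "{D}"] assms by auto
  then show thesis
    using that by (auto simp: Int_commute)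
qed

lemma region_baire:
  assumes "D \<in> \<C>"
  shows "baire_set X \<C> D"
  unfolding baire_set_def
proof (intro conjI ballI)
  show "D \<subseteq> X"
    using assms by (rule region_subset)
next
  fix E assume "E \<in> \<C>"
  show "\<exists>G. subregion \<C> G E \<and> (meager_in X \<C> D G \<or> meager_in X \<C> (X - D) G)"
  proof (rule region_inter_or_disjoint[OF assms \<open>E \<in> \<C>\<close>])
    fix G assume G: "subregion \<C> G (D \<inter> E)"
    then have "(X - D) \<inter> G = {}"
      by (auto simp: subregion_def)
    with G show ?thesis
      by (intro exI[of _ G]) (auto simp: subregion_def meager_in_def meager_empty)
  next
    fix G assume G: "subregion \<C> G E" "disjnt G D"
    then have "D \<inter> G = {}"
      by (auto simp: disjnt_def)
    with G(1) show ?thesis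
      by (intro exI[of _ G]) (auto simp: meager_in_def meager_empty)
  qed
qed

section \<open>Disjoint families of regions and the Banach category theorem\<close>

text \<open>
  The family is built by recursion along a well-order of \<open>\<C>\<close> of minimal type, so that fewer than
  \<open>|\<C>|\<close> regions have been selected before each stage and the axioms apply to them.
\<close>

lemma disjoint_refinement:
  assumes N: "\<N> \<subseteq> \<C>" and dense: "\<And>D. D \<in> \<C> \<Longrightarrow> \<exists>E\<in>\<N>. E \<subseteq> D"
  obtains \<M> where "\<M> \<subseteq> \<N>" and "disjoint \<M>"
    and "\<And>D. D \<in> \<C> \<Longrightarrow> \<exists>M\<in>\<M>. \<exists>R. subregion \<C> R (D \<inter> M)"
proof -
  define r where "r = card_of \<C>"
  have fld: "Field r = \<C>"
    unfolding r_def by (rule Field_card_of)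
  have co: "Card_order r"
    unfolding r_def by (rule card_of_Card_order)
  then have wo: "Well_order r"
    unfolding card_order_on_def by blast
  then have wf: "wf (r - Id)"
    unfolding well_order_on_def by blast
  have fld': "a \<in> \<C> \<and> b \<in> \<C>" if "(a, b) \<in> r" for a b
    using that fld by (auto simp: Field_def)
  \<comment> \<open>Here \<open>S\<close> is the choice at stage \<open>a\<close>, and
    \<open>f\<close> holds the earlier choices. Equality with some \<open>f b\<close> is allowed
    because an earlier choice may already serve for \<open>a\<close>.\<close>
  let ?P = "\<lambda>f a S. a \<in> \<C> \<longrightarrow> S \<in> \<N> \<and> (\<exists>R. subregion \<C> R (a \<inter> S)) \<and>
    (\<forall>b. (b, a) \<in> r - Id \<longrightarrow> S = f b \<or> disjnt S (f b))"
  have "\<exists>f. \<forall>a. ?P f a (f a)"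
  proof (rule dependent_wf_choice[OF wf])
    fix f g :: "'a set \<Rightarrow> 'a set" and a S
    assume "\<And>z. (z, a) \<in> r - Id \<Longrightarrow> f z = g z"
    then show "?P f a S = ?P g a S"
      by auto
  next
    fix a and f :: "'a set \<Rightarrow> 'a set"
    assume IH: "\<And>b. (b, a) \<in> r - Id \<Longrightarrow> ?P f b (f b)"
    show "\<exists>S. ?P f a S"
    proof (cases "a \<in> \<C>")
      case a: True
      define \<D> where "\<D> = f ` underS r a"
      have D_iff: "S \<in> \<D> \<longleftrightarrow> (\<exists>b. (b, a) \<in> r - Id \<and> S = f b)" for S
        unfolding \<D>_def underS_def by auto
      have DN: "\<D> \<subseteq> \<N>"
      proof
        fix S assume "S \<in> \<D>"
        then obtain b where b: "(b, a) \<in> r - Id" "S = f b"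
          unfolding D_iff by blast
        then show "S \<in> \<N>"
          using IH[OF b(1)] fld'[of b a] by simp
      qed
      have disj: "S = T \<or> disjnt S T" if ST: "S \<in> \<D>" "T \<in> \<D>" for S T
      proof -
        obtain b c where b: "(b, a) \<in> r - Id" "S = f b" and c: "(c, a) \<in> r - Id" "T = f c"
          using ST unfolding D_iff by blast
        have "b = c \<or> (b, c) \<in> r - Id \<or> (c, b) \<in> r - Id"
          using wo b(1) c(1) fld fld'[of b a] fld'[of c a]
          by (auto simp: well_order_on_def linear_order_on_def total_on_def)
        then show ?thesis
          using IH[OF b(1)] IH[OF c(1)] b c fld'[of b a] fld'[of c a]
          by (auto simp: disjnt_def Int_commute)
      qed
      \<comment> \<open>Since \<open>r\<close> is a cardinal order, its proper initial segments have
        smaller cardinality than its field; passing to the image under \<open>f\<close> cannot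
        enlarge them.\<close>
      have "\<not> \<C> \<lesssim> underS r a"
        using card_of_underS[OF co, of a] a fld not_ordLess_ordLeq
        unfolding r_def lepoll_def card_of_ordLeq by blast
      moreover have "underS r a \<lesssim> \<C>"
        using fld' by (intro subset_imp_lepoll) (auto simp: underS_def)
      ultimately have "underS r a \<prec> \<C>"
        using eqpoll_imp_lepoll eqpoll_sym unfolding lesspoll_def by blast
      then have small: "\<D> \<prec> \<C>"
        unfolding \<D>_def by (rule lesspoll_trans1[OF image_lepoll])
      have DC: "\<D> \<subseteq> \<C>" "disjoint \<D>"
        using DN N disj unfolding pairwise_def by blast+
      have reduce: "\<exists>S. ?P f a S"
        if S: "S \<in> \<N>" "\<exists>R. subregion \<C> R (a \<inter> S)" "\<And>T. T \<in> \<D> \<Longrightarrow> S = T \<or> disjnt S T" for S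
        using S unfolding D_iff by (intro exI[of _ S]) blast
      show ?thesis
      \<comment> \<open>If the earlier choices cover a subregion of \<open>a\<close>, the first half
        of the axiom supplies one of them to reuse. Otherwise there is a subregion \<open>B\<close>
        of \<open>a\<close> disjoint from all of them (\<open>a\<close> itself at the start), and a
        member of \<open>\<N>\<close> inside \<open>B\<close> is a new choice.\<close>
      proof (cases "\<D> \<noteq> {} \<and> (\<exists>R. subregion \<C> R (a \<inter> \<Union>\<D>))")
        case True
        then obtain D where "D \<in> \<D>" "\<exists>R. subregion \<C> R (a \<inter> D)"
          using contains_region[OF a _ DC small] by blast
        then show ?thesis
          using DN disj by (intro reduce[of D]) auto
      next
        case False
        have "\<exists>B. subregion \<C> B a \<and> (\<forall>D\<in>\<D>. disjnt B D)"
        proof (cases "\<D> = {}")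
          case True
          with a show ?thesis
            by (auto simp: subregion_def)
        next
          case nonempty: False
          with False show ?thesis
            using contains_no_region[OF a _ DC small] by blast
        qed
        then obtain B where B: "subregion \<C> B a" "\<forall>D\<in>\<D>. disjnt B D"
          by blast
        then obtain E where E: "E \<in> \<N>" "E \<subseteq> B"
          using dense[of B] by (auto simp: subregion_def)
        have "subregion \<C> E (a \<inter> E)"
          using E B(1) N by (auto simp: subregion_def)
        then show ?thesis
          using E B(2) by (intro reduce[of E]) (auto simp: disjnt_def)
      qed
    qed simp
  qed
  then obtain f where f: "\<And>a. ?P f a (f a)"
    by blast
  show thesis
  proof (rule that[of "f ` \<C>"])
    show "f ` \<C> \<subseteq> \<N>"
      using f by blast
    show "disjoint (f ` \<C>)"
      unfolding pairwise_def
    proof (intro ballI impI)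
      fix S T assume "S \<in> f ` \<C>" "T \<in> f ` \<C>" "S \<noteq> T"
      then obtain b c where b: "b \<in> \<C>" "S = f b" and c: "c \<in> \<C>" "T = f c"
        by blast
      have "b = c \<or> (b, c) \<in> r - Id \<or> (c, b) \<in> r - Id"
        using wo b(1) c(1) fld
        by (auto simp: well_order_on_def linear_order_on_def total_on_def)
      then show "disjnt S T"
        using f[of b] f[of c] b c \<open>S \<noteq> T\<close> by (auto simp: disjnt_def Int_commute)
    qed
    show "\<exists>M\<in>f ` \<C>. \<exists>R. subregion \<C> R (D \<inter> M)" if "D \<in> \<C>" for D
      using f[of D] that by blast
  qed
qed

text \<open>On a disjoint family \<open>\<M>\<close> of regions in which \<open>S\<close> is meager,
  the countable decompositions can be merged index by index: locally only one member of
  \<open>\<M>\<close> matters. What \<open>S\<close> has outside \<open>\<Union>\<M>\<close> is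
  singular, because every region shares a subregion with some member.\<close>

theorem banach_category:
  assumes S: "S \<subseteq> X" and dense: "\<And>D. D \<in> \<C> \<Longrightarrow> \<exists>E. subregion \<C> E D \<and> meager_in X \<C> S E"
  shows "meager_set X \<C> S"
proof -
  define \<N> where "\<N> = {E \<in> \<C>. meager_in X \<C> S E}"
  have "\<N> \<subseteq> \<C>" "\<And>D. D \<in> \<C> \<Longrightarrow> \<exists>E\<in>\<N>. E \<subseteq> D"
    using dense by (auto simp: \<N>_def subregion_def)
  then obtain \<M> where MN: "\<M> \<subseteq> \<N>" and disj: "disjoint \<M>"
    and M: "\<And>D. D \<in> \<C> \<Longrightarrow> \<exists>M\<in>\<M>. \<exists>R. subregion \<C> R (D \<inter> M)"
    using disjoint_refinement by metis
  have "\<forall>M\<in>\<M>. \<exists>T::nat \<Rightarrow> 'a set. (\<forall>n. singular_set X \<C> (T n)) \<and> S \<inter> M = (\<Union>n. T n)"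
    using MN by (auto simp: \<N>_def meager_in_def meager_iff_sequence)
  then obtain T :: "'a set \<Rightarrow> nat \<Rightarrow> 'a set"
    where T: "\<And>M n. M \<in> \<M> \<Longrightarrow> singular_set X \<C> (T M n)"
      and T_Un: "\<And>M. M \<in> \<M> \<Longrightarrow> S \<inter> M = (\<Union>n. T M n)"
    by metis
  \<comment> \<open>Inside \<open>D\<close>, first move to a region within one \<open>M\<close>. The
    pieces of every other \<open>M'\<close> lie in \<open>M'\<close> and so miss it, and only
    \<open>T M n\<close> remains to be avoided.\<close>
  have "singular_set X \<C> (\<Union>M\<in>\<M>. T M n)" for n
    unfolding singular_set_def
  proof (intro conjI ballI)
    show "(\<Union>M\<in>\<M>. T M n) \<subseteq> X"
      using T by (auto simp: singular_set_def)
    fix D assume "D \<in> \<C>"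
    then obtain M R where MR: "M \<in> \<M>" "subregion \<C> R (D \<inter> M)"
      using M by blast
    then obtain E where E: "subregion \<C> E R" "disjnt E (T M n)"
      using T[OF MR(1), of n] by (auto simp: singular_set_def subregion_def)
    have "disjnt E (T M' n)" if "M' \<in> \<M>" for M'
    proof (cases "M' = M")
      case False
      then have "M' \<inter> M = {}"
        using disj that MR(1) by (auto simp: disjoint_def)
      moreover have "E \<subseteq> M" "T M' n \<subseteq> M'"
        using E MR T_Un[OF that] by (auto simp: subregion_def)
      ultimately show ?thesis
        by (auto simp: disjnt_def)
    qed (use E in simp)
    then show "\<exists>E. subregion \<C> E D \<and> disjnt E (\<Union>M\<in>\<M>. T M n)"
      using E MR(2) by (intro exI[of _ E]) (auto simp: subregion_def disjnt_def)
  qed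
  then have mT: "meager_set X \<C> (\<Union>n. \<Union>M\<in>\<M>. T M n)"
    unfolding meager_iff_sequence by (intro exI[of _ "\<lambda>n. \<Union>M\<in>\<M>. T M n"] conjI allI refl)
  have "singular_set X \<C> (S - \<Union>\<M>)"
    unfolding singular_set_def
  proof (intro conjI ballI)
    fix D assume "D \<in> \<C>"
    then obtain M R where "M \<in> \<M>" "subregion \<C> R (D \<inter> M)"
      using M by blast
    then show "\<exists>E. subregion \<C> E D \<and> disjnt E (S - \<Union>\<M>)"
      by (intro exI[of _ R]) (auto simp: subregion_def disjnt_def)
  qed (use S in auto)
  then have "meager_set X \<C> ((S - \<Union>\<M>) \<union> (\<Union>n. \<Union>M\<in>\<M>. T M n))"
    using mT by (rule meager_Un[OF singular_imp_meager])
  moreover have "S \<subseteq> (S - \<Union>\<M>) \<union> (\<Union>n. \<Union>M\<in>\<M>. T M n)"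
  proof
    fix x assume x: "x \<in> S"
    show "x \<in> (S - \<Union>\<M>) \<union> (\<Union>n. \<Union>M\<in>\<M>. T M n)"
    proof (cases "x \<in> \<Union>\<M>")
      case True
      then obtain M where M: "M \<in> \<M>" "x \<in> S \<inter> M"
        using x by blast
      then show ?thesis
        unfolding T_Un[OF M(1)] by blast
    qed (use x in blast)
  qed
  ultimately show ?thesis
    by (rule meager_subset)
qed

section \<open>Baire sets and complete non-Baireness\<close>

lemma abundant_baire_comeager_subregion:
  assumes B: "baire_set X \<C> B" and D: "D \<in> \<C>" and ab: "abundant_set X \<C> (B \<inter> D)"
  obtains G where "subregion \<C> G D" and "meager_in X \<C> (X - B) G"
proof -
  \<comment> \<open>This is the contrapositive of \<open>banach_category\<close>. The region
    \<open>E\<close> need not lie in \<open>D\<close>, which is why the argument later compares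
    \<open>D\<close> with a subregion of \<open>E\<close>.\<close>
  obtain E where E: "E \<in> \<C>" "\<And>F. subregion \<C> F E \<Longrightarrow> \<not> meager_in X \<C> (B \<inter> D) F"
    using ab banach_category[of "B \<inter> D"] unfolding abundant_set_def by blast
  obtain F where F: "subregion \<C> F E" "meager_in X \<C> B F \<or> meager_in X \<C> (X - B) F"
    using B E(1) unfolding baire_set_def by blast
  have "\<not> meager_in X \<C> B F"
    using E(2)[OF F(1)] meager_subset[of "B \<inter> F" "B \<inter> D \<inter> F"] unfolding meager_in_def by blast
  then have FB: "meager_in X \<C> (X - B) F"
    using F(2) by blast
  have "F \<in> \<C>"
    using F(1) by (simp add: subregion_def)
  show thesis
  proof (rule region_inter_or_disjoint[OF D \<open>F \<in> \<C>\<close>])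
    fix G assume G: "subregion \<C> G (D \<inter> F)"
    then have "(X - B) \<inter> G \<subseteq> (X - B) \<inter> F"
      by (auto simp: subregion_def)
    then have "meager_in X \<C> (X - B) G"
      using FB meager_subset unfolding meager_in_def by blast
    with G show thesis
      by (intro that[of G]) (auto simp: subregion_def)
  next
    fix G assume G: "subregion \<C> G F" "disjnt G D"
    \<comment> \<open>A subregion of \<open>E\<close> that misses \<open>D\<close> would meet
      \<open>B \<inter> D\<close> in the empty, hence meager, set, against the choice of
      \<open>E\<close>.\<close>
    then have "B \<inter> D \<inter> G = {}" "subregion \<C> G E"
      using F(1) by (auto simp: disjnt_def subregion_def)
    then show thesis
      using E(2)[of G] meager_empty by (simp add: meager_in_def)
  qed
qed

lemma nonbaire_imp_completely_nonbaire_in: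
  assumes "nonbaire_set X \<C> A"
  shows "\<exists>D\<in>\<C>. completely_nonbaire_in X \<C> A D"
proof -
  have A: "A \<subseteq> X"
    using assms by (simp add: nonbaire_set_def)
  obtain D where D: "D \<in> \<C>"
    and nm: "\<And>E. subregion \<C> E D \<Longrightarrow> \<not> meager_in X \<C> A E \<and> \<not> meager_in X \<C> (X - A) E"
    using assms unfolding nonbaire_set_def baire_set_def by blast
  have "abundant_set X \<C> (A \<inter> B) \<and> abundant_set X \<C> ((D - A) \<inter> B)"
    if B: "baire_set X \<C> B" and ab: "abundant_set X \<C> (B \<inter> D)" for B
  proof -
    obtain G where G: "subregion \<C> G D" "meager_in X \<C> (X - B) G"
      using abundant_baire_comeager_subregion[OF B D ab] .
    \<comment> \<open>If \<open>U\<close> were meager, then together with the meager set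
      \<open>(X - B) \<inter> G\<close> it would cover \<open>S \<inter> G\<close>. This is used
      with \<open>S\<close> equal to \<open>A\<close> and to \<open>X - A\<close>.\<close>
    have abundant: "\<not> meager_set X \<C> U" if "S \<inter> G \<subseteq> U \<union> (X - B) \<inter> G" "\<not> meager_in X \<C> S G" for S U
      using that G(2) meager_Un meager_subset unfolding meager_in_def by blast
    have "G \<subseteq> D" "D \<subseteq> X"
      using G(1) region_subset[OF D] by (auto simp: subregion_def)
    then have sub: "A \<inter> G \<subseteq> A \<inter> B \<union> (X - B) \<inter> G"
      "(X - A) \<inter> G \<subseteq> (D - A) \<inter> B \<union> (X - B) \<inter> G"
      by auto
    have "\<not> meager_set X \<C> (A \<inter> B)" "\<not> meager_set X \<C> ((D - A) \<inter> B)"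
      using nm[OF G(1)] abundant[OF sub(1)] abundant[OF sub(2)] by (iprover)+
    with A \<open>D \<subseteq> X\<close> show ?thesis
      by (auto simp: abundant_set_def)
  qed
  with A D show ?thesis
    unfolding completely_nonbaire_in_def by blast
qed

end

lemma (in baire_base) completely_nonbaire_in_imp_nonbaire:
  assumes D: "D \<in> \<C>" and A: "completely_nonbaire_in X \<C> A D"
  shows "nonbaire_set X \<C> A"
  unfolding nonbaire_set_def
proof
  show "A \<subseteq> X"
    using A by (simp add: completely_nonbaire_in_def)
  show "\<not> baire_set X \<C> A"
  proof
    assume "baire_set X \<C> A"
    then obtain E where E: "subregion \<C> E D" "meager_in X \<C> A E \<or> meager_in X \<C> (X - A) E"
      using D unfolding baire_set_def by blast
    have ED: "E \<in> \<C>" "E \<inter> D = E" "(D - A) \<inter> E \<subseteq> (X - A) \<inter> E"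
      using E(1) region_subset[OF D] by (auto simp: subregion_def)
    \<comment> \<open>The test set is \<open>E\<close> itself: it is Baire as a region, and
      \<open>E \<inter> D = E\<close> is abundant because the base is a Baire base. Both
      alternatives for \<open>E\<close> are thereby contradicted.\<close>
    then have "abundant_set X \<C> (A \<inter> E)" "abundant_set X \<C> ((D - A) \<inter> E)"
      using A region_baire[of E] region_abundant[of E] unfolding completely_nonbaire_in_def by auto
    with E(2) ED(3) show False
      using meager_subset unfolding abundant_set_def meager_in_def by blast
  qed
qed

theorem theorem9:
  fixes X :: "'a set" and \<C> :: "'a set set" and A :: "'a set"
  assumes "baire_base X \<C>"
    and "A \<subseteq> X"
  shows "nonbaire_set X \<C> A \<longleftrightarrow> (\<exists>D\<in>\<C>. completely_nonbaire_in X \<C> A D)"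
proof -
  interpret baire_base X \<C>
    by (rule assms(1))
  show ?thesis
    using nonbaire_imp_completely_nonbaire_in completely_nonbaire_in_imp_nonbaire by blast
qed

end
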